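(* Let $r\ge 3$ be a fixed integer. Then there exist positive constants $c_r$ and $c_r'$ (depending only on $r$) such that for all sufficiently large $N$: (a) $\mathrm{ex}_r(N, \mathcal{C}_{<5}) \geq c_r \cdot N^{10/7}$, and (b) $\mathrm{ex}_r(N, \mathcal{C}_{<6}) \geq c_r'\cdot N^{4/3}$.
   Context: An $r$-uniform hypergraph on a finite vertex set $X$ is a collection of $r$-element subsets (edges) of $X$. A Berge cycle of length $k\ge 2$ in a hypergraph is a sequence of $k$ distinct vertices $v_1,\dots,v_k$ and $k$ distinct edges $E_1,\dots,E_k$ such that $\{v_i,v_{i+1}\}\subseteq E_i$ for all $i$, indices read modulo $k$. $\mathcal{C}_{<g}$ denotes the family of Berge cycles of lengths $2,3,\dots,g-1$; a hypergraph is $\mathcal{C}_{<g}$-free if it contains no Berge cycle of length $k$ for any $2\le k\le g-1$. $\mathrm{ex}_r(N,\mathcal{C}_{<g})$ denotes the maximum number of edges in an $N$-vertex $r$-uniform $\mathcal{C}_{<g}$-free hypergraph. *)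

theory Defs
  imports Complex_Main
begin

definition uniform_hypergraph :: "nat \<Rightarrow> 'a set \<Rightarrow> 'a set set \<Rightarrow> bool" where
  "uniform_hypergraph r X H \<longleftrightarrow> finite X \<and> (\<forall>e\<in>H. e \<subseteq> X \<and> card e = r)"

text \<open>The vertices and edges of a cycle of length \<open>k\<close> are indexed by \<open>0, \<dots>, k - 1\<close>;
  values of \<open>v\<close> and \<open>E\<close> at other indices are irrelevant.\<close>

definition berge_cycle ::
    "'a set set \<Rightarrow> nat \<Rightarrow> (nat \<Rightarrow> 'a) \<Rightarrow> (nat \<Rightarrow> 'a set) \<Rightarrow> bool" where
  "berge_cycle H k v E \<longleftrightarrow>
     2 \<le> k \<and> inj_on v {..<k} \<and> inj_on E {..<k} \<and> E ` {..<k} \<subseteq> H \<and>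
     (\<forall>i<k. {v i, v (Suc i mod k)} \<subseteq> E i)"

definition berge_free :: "nat \<Rightarrow> 'a set set \<Rightarrow> bool" where
  "berge_free g H \<longleftrightarrow> (\<forall>k. 2 \<le> k \<and> k < g \<longrightarrow> (\<nexists>v E. berge_cycle H k v E))"

text \<open>The vertex set is taken to be \<open>{..<N}\<close>; by \<open>card_le_berge_ex\<close> below this loses no
  generality. The maximum is over a finite nonempty set (\<open>finite_berge_sizes\<close>,
  \<open>berge_sizes_nonempty\<close>).\<close>

definition berge_ex :: "nat \<Rightarrow> nat \<Rightarrow> nat \<Rightarrow> nat" where
  "berge_ex r g N = Max {card H | H. uniform_hypergraph r {..<N} H \<and> berge_free g H}"

lemma finite_berge_sizes:
  "finite {card H | H. uniform_hypergraph r {..<N::nat} H \<and> berge_free g H}"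
proof (rule finite_subset)
  show "{card H | H. uniform_hypergraph r {..<N::nat} H \<and> berge_free g H}
      \<subseteq> card ` Pow (Pow {..<N::nat})"
    by (auto simp: uniform_hypergraph_def)
qed simp

lemma berge_sizes_nonempty:
  "{card H | H. uniform_hypergraph r {..<N::nat} H \<and> berge_free g H} \<noteq> {}"
proof -
  have "uniform_hypergraph r {..<N::nat} {} \<and> berge_free g ({} :: nat set set)"
    by (auto simp: uniform_hypergraph_def berge_free_def berge_cycle_def lessThan_empty_iff)
  then show ?thesis by blast
qed

lemma card_le_berge_ex:
  assumes H: "uniform_hypergraph r X H" "berge_free g H" and N: "card X = N"
  shows "card H \<le> berge_ex r g N"
proof -
  have fin: "finite X" and sub: "H \<subseteq> Pow X"
    using H by (auto simp: uniform_hypergraph_def)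
  obtain f where f: "bij_betw f X {..<N::nat}"
    using ex_bij_betw_finite_nat[OF fin] N by (auto simp: lessThan_atLeast0)
  have injf: "inj_on f X" using f by (rule bij_betw_imp_inj_on)
  define h where "h = inv_into X f"
  define H' where "H' = image f ` H"
  have hf: "h ` f ` e = e" if "e \<in> H" for e
    using that sub injf by (auto simp: h_def intro!: inv_into_image_cancel)
  have inj: "inj_on (image f) H"
    by (rule inj_on_inverseI[where g = "image h"]) (rule hf)
  have "uniform_hypergraph r {..<N::nat} H'"
    unfolding uniform_hypergraph_def
  proof (intro conjI ballI)
    fix e' assume "e' \<in> H'"
    then obtain e where e: "e \<in> H" "e' = f ` e" by (auto simp: H'_def)
    then have "e \<subseteq> X" "card e = r" using H by (auto simp: uniform_hypergraph_def)
    then show "e' \<subseteq> {..<N}" "card e' = r"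
      using e f injf by (auto simp: bij_betw_def card_image inj_on_subset)
  qed simp
  moreover have "berge_free g H'"
    unfolding berge_free_def
  proof (intro allI impI, rule notI, elim exE)
    fix k v E assume k: "2 \<le> k \<and> k < g" and c: "berge_cycle H' k v E"
    have EH: "h ` E i \<in> H" "E i = f ` h ` E i" if "i < k" for i
    proof -
      have "E i \<in> H'" using c that unfolding berge_cycle_def by auto
      then obtain e where "e \<in> H" "E i = f ` e" by (auto simp: H'_def)
      then show "h ` E i \<in> H" "E i = f ` h ` E i" using hf[of e] by simp_all
    qed
    have vN: "v i \<in> f ` X" if "i < k" for i
    proof -
      have "v i \<in> E i" using c that by (auto simp: berge_cycle_def)
      also have "\<dots> = f ` h ` E i" by (rule EH(2)[OF that])
      finally show ?thesis using EH(1)[OF that] sub by blast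
    qed
    have "berge_cycle H k (h \<circ> v) (\<lambda>i. h ` E i)"
      unfolding berge_cycle_def
    proof (intro conjI)
      show "inj_on (h \<circ> v) {..<k}"
        using c vN unfolding h_def
        by (intro comp_inj_on) (auto simp: berge_cycle_def intro!: inj_on_inv_into)
      show "inj_on (\<lambda>i. h ` E i) {..<k}"
      proof (rule inj_onI)
        fix i j assume ij: "i \<in> {..<k}" "j \<in> {..<k}" "h ` E i = h ` E j"
        then have "f ` h ` E i = f ` h ` E j" by simp
        then have "E i = E j" using EH(2)[of i] EH(2)[of j] ij by simp
        then show "i = j" using c ij unfolding berge_cycle_def by (meson inj_onD)
      qed
      show "(\<lambda>i. h ` E i) ` {..<k} \<subseteq> H" using EH(1) by auto
      show "\<forall>i<k. {(h \<circ> v) i, (h \<circ> v) (Suc i mod k)} \<subseteq> h ` E i"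
        using c by (auto simp: berge_cycle_def)
    qed (use k in simp)
    then show False using H(2) k by (auto simp: berge_free_def)
  qed
  ultimately have "card H' \<le> berge_ex r g N"
    unfolding berge_ex_def by (intro Max_ge[OF finite_berge_sizes]) blast
  then show ?thesis using inj by (simp add: H'_def card_image)
qed

end

theory Submission
  imports Defs "HOL-Algebra.Algebraic_Closure_Type"
begin

text \<open>
  The hypergraphs are cut out of the generalized hexagon of the triality groups. Let \<open>L\<close> be the
  cubic extension of the field \<open>F\<close> with \<open>q\<close> elements, and put \<open>v(t) = (1, t, adj t, nrm t)\<close> for
  \<open>t \<in> L\<close>, where \<open>\<sigma>\<close> generates the Galois group, \<open>adj t = \<sigma> t * \<sigma> (\<sigma> t)\<close> and
  \<open>nrm t = t * adj t\<close>. Edges are lines with direction \<open>v(t)\<close> in \<open>F \<times> L \<times> L \<times> F\<close>, restricted to the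
  \<open>r\<close> points whose first coordinate lies in a fixed Sidon set; a Berge cycle gives a linear
  relation between the vectors \<open>v(t)\<close>. Any four of these vectors are linearly independent over
  \<open>F\<close>: a relation between \<open>1\<close>, \<open>t\<close> and \<open>adj t\<close> forces the \<open>t\<close> onto an affine \<open>F\<close>-line, where \<open>nrm\<close>
  is a cubic polynomial with nonzero leading coefficient. Only the parallelogram relation
  remains, which the Sidon set forbids. This gives \<open>q^10\<close> edges on \<open>r q^7\<close> vertices without
  cycles of length up to 4.

  For cycles of length 5 the space is replaced by its Heisenberg extension by \<open>F\<close>, along the
  alternating form with \<open>\<omega>(v(s), v(t)) = nrm (t - s)\<close>. A pentagon then also satisfies a quadratic
  relation. After moving one direction \<open>u\<close> to infinity by \<open>t \<mapsto> 1 / (t - u)\<close> the other four lie on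
  an \<open>F\<close>-line, where this relation is contradictory. This gives \<open>q^11\<close> edges on \<open>r q^8\<close> vertices,
  and \<open>11 / 8 > 4 / 3\<close>. Letting \<open>q\<close> run through the powers of 3 loses only a constant factor.
\<close>

subsection \<open>Fields with an automorphism of order three\<close>

text \<open>\<open>\<sigma>\<close> acts on an ambient field, later an algebraic closure, and its
  cube is the identity only on \<open>L\<close>. Treating \<open>F\<close> and \<open>L\<close> as
  subsets of one field avoids types for subfields.\<close>

locale order_three_endomorphism =
  fixes \<sigma> :: "'a::field \<Rightarrow> 'a"
  assumes add: "\<sigma> (x + y) = \<sigma> x + \<sigma> y"
    and mult: "\<sigma> (x * y) = \<sigma> x * \<sigma> y"
    and one: "\<sigma> 1 = 1"
    and two_neq_zero: "(2::'a) \<noteq> 0"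
begin

lemma zero: "\<sigma> 0 = 0"
proof -
  have "\<sigma> 0 + \<sigma> 0 = \<sigma> 0 + 0" using add[of 0 0] by simp
  then show ?thesis by (simp only: add_left_cancel)
qed

lemma minus: "\<sigma> (- x) = - \<sigma> x"
  using add[of x "- x"] zero by (simp add: add_eq_0_iff)

lemma diff: "\<sigma> (x - y) = \<sigma> x - \<sigma> y"
  using add[of x "- y"] minus by simp

lemma inverse: "\<sigma> (inverse x) = inverse (\<sigma> x)"
proof (cases "x = 0")
  case False
  then have "\<sigma> x * \<sigma> (inverse x) = 1"
    using mult[of x "inverse x"] one by simp
  then show ?thesis by (simp add: inverse_unique)
qed (simp add: zero)

lemma divide: "\<sigma> (x / y) = \<sigma> x / \<sigma> y"
  by (simp add: divide_inverse mult inverse)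

lemma eq_0_iff: "\<sigma> x = 0 \<longleftrightarrow> x = 0"
proof (cases "x = 0")
  case False
  then have "\<sigma> x * \<sigma> (inverse x) = 1"
    using mult[of x "inverse x"] one by simp
  then show ?thesis using False by auto
qed (simp add: zero)

lemmas hom = zero one add mult minus diff inverse divide

section \<open>The two fixed fields, with norm, trace and quadratic adjoint\<close>

definition L :: "'a set" where "L = {x. \<sigma> (\<sigma> (\<sigma> x)) = x}"

definition F :: "'a set" where "F = {x. \<sigma> x = x}"

definition adj :: "'a \<Rightarrow> 'a" where "adj x = \<sigma> x * \<sigma> (\<sigma> x)"

definition nrm :: "'a \<Rightarrow> 'a" where "nrm x = x * adj x"

definition tr :: "'a \<Rightarrow> 'a" where "tr x = x + \<sigma> x + \<sigma> (\<sigma> x)"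

lemma sigma_F: "c \<in> F \<Longrightarrow> \<sigma> c = c"
  by (simp add: F_def)

lemma sigma_L: "x \<in> L \<Longrightarrow> \<sigma> (\<sigma> (\<sigma> x)) = x"
  by (simp add: L_def)

lemma F_subset_L: "F \<subseteq> L"
  by (auto simp: L_def F_def)

lemma F_closed:
  "0 \<in> F" "1 \<in> F"
  "x \<in> F \<Longrightarrow> y \<in> F \<Longrightarrow> x + y \<in> F"
  "x \<in> F \<Longrightarrow> y \<in> F \<Longrightarrow> x - y \<in> F"
  "x \<in> F \<Longrightarrow> y \<in> F \<Longrightarrow> x * y \<in> F"
  "x \<in> F \<Longrightarrow> - x \<in> F"
  by (simp_all add: F_def hom)

lemma L_closed:
  "x \<in> L \<Longrightarrow> y \<in> L \<Longrightarrow> x + y \<in> L"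
  "x \<in> L \<Longrightarrow> y \<in> L \<Longrightarrow> x - y \<in> L"
  "x \<in> L \<Longrightarrow> y \<in> L \<Longrightarrow> x * y \<in> L"
  "x \<in> L \<Longrightarrow> y \<in> L \<Longrightarrow> x / y \<in> L"
  "x \<in> L \<Longrightarrow> \<sigma> x \<in> L"
  "x \<in> L \<Longrightarrow> adj x \<in> L"
  by (simp_all add: L_def hom adj_def)

lemma nrm_in_F: "x \<in> L \<Longrightarrow> nrm x \<in> F"
  and tr_in_F: "x \<in> L \<Longrightarrow> tr x \<in> F"
  by (simp_all add: L_def F_def hom adj_def nrm_def tr_def)

lemma adj_mult: "adj (x * y) = adj x * adj y"
  and nrm_mult: "nrm (x * y) = nrm x * nrm y"
  by (simp_all add: adj_def nrm_def hom)

lemma nrm_eq_0_iff: "nrm x = 0 \<longleftrightarrow> x = 0"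
  by (simp add: adj_def nrm_def eq_0_iff)

lemma adj_eq_0_iff: "adj x = 0 \<longleftrightarrow> x = 0"
  by (simp add: adj_def eq_0_iff)

lemma nrm_F: "c \<in> F \<Longrightarrow> nrm c = c ^ 3"
  and adj_F: "c \<in> F \<Longrightarrow> adj c = c ^ 2"
  by (simp_all add: adj_def nrm_def F_def power2_eq_square power3_eq_cube)

text \<open>Multiplying \<open>quad\<close> by \<open>c3\<close> and eliminating \<open>y3\<close>
  leaves a bilinear relation with symmetric matrix \<open>A, B; B, C\<close> over \<open>F\<close>
  between the pairs \<open>(\<sigma> y1, \<sigma> y2)\<close> and
  \<open>(\<sigma> (\<sigma> y1), \<sigma> (\<sigma> y2))\<close>. By conjugation the pair
  \<open>(y1, y2)\<close> is orthogonal to the latter as well. If the first two conjugate pairs were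
  independent, the third would lie in the kernel of the matrix; then so would its conjugates,
  forcing \<open>B = 0\<close>.\<close>

lemma proportional:
  assumes L: "y1 \<in> L" "y2 \<in> L" "y3 \<in> L" and F: "c1 \<in> F" "c2 \<in> F" "c3 \<in> F"
    and nz: "c1 \<noteq> 0" "c2 \<noteq> 0"
    and lin: "c1 * y1 + c2 * y2 + c3 * y3 = 0"
    and quad: "c1 * adj y1 + c2 * adj y2 + c3 * adj y3 = 0"
  shows "y1 * \<sigma> y2 = y2 * \<sigma> y1"
proof (rule ccontr)
  assume neq: "y1 * \<sigma> y2 \<noteq> y2 * \<sigma> y1"
  define A B C where "A = c1 * c3 + c1 ^ 2" and "B = c1 * c2" and "C = c2 * c3 + c2 ^ 2"
  note s = sigma_F[OF F(1)] sigma_F[OF F(2)] sigma_F[OF F(3)]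
    sigma_L[OF L(1)] sigma_L[OF L(2)] sigma_L[OF L(3)]
  have ABC: "\<sigma> A = A" "\<sigma> B = B" "\<sigma> C = C"
    by (simp_all add: A_def B_def C_def power2_eq_square hom s)
  have lin1: "c1 * \<sigma> y1 + c2 * \<sigma> y2 + c3 * \<sigma> y3 = 0"
    using arg_cong[OF lin, of \<sigma>] by (simp add: hom s)
  have lin2: "c1 * \<sigma> (\<sigma> y1) + c2 * \<sigma> (\<sigma> y2) + c3 * \<sigma> (\<sigma> y3) = 0"
    using arg_cong[OF lin1, of \<sigma>] by (simp add: hom s)
  have e1: "\<sigma> y1 * (A * \<sigma> (\<sigma> y1) + B * \<sigma> (\<sigma> y2)) + \<sigma> y2 * (B * \<sigma> (\<sigma> y1) + C * \<sigma> (\<sigma> y2)) = 0"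
    using quad lin1 lin2 unfolding adj_def A_def B_def C_def by Groebner_Basis.algebra
  have e2: "\<sigma> (\<sigma> y1) * (A * y1 + B * y2) + \<sigma> (\<sigma> y2) * (B * y1 + C * y2) = 0"
    using arg_cong[OF e1, of \<sigma>] by (simp add: hom s ABC)
  define P Q where "P = A * \<sigma> (\<sigma> y1) + B * \<sigma> (\<sigma> y2)" and "Q = B * \<sigma> (\<sigma> y1) + C * \<sigma> (\<sigma> y2)"
  have e1': "\<sigma> y1 * P + \<sigma> y2 * Q = 0" using e1 by (simp add: P_def Q_def)
  have e2': "y1 * P + y2 * Q = 0" using e2 unfolding P_def Q_def by Groebner_Basis.algebra
  have "(y1 * \<sigma> y2 - y2 * \<sigma> y1) * P = 0"
    using e1' e2' by Groebner_Basis.algebra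
  then have "P = 0" using neq by simp
  then have "\<sigma> P = 0" by (simp add: hom)
  then have 1: "A * y1 + B * y2 = 0" unfolding P_def by (simp add: hom ABC s)
  have 2: "A * \<sigma> y1 + B * \<sigma> y2 = 0"
    using arg_cong[OF 1, of \<sigma>] by (simp add: hom ABC)
  have "B * (y1 * \<sigma> y2 - y2 * \<sigma> y1) = 0" using 1 2 by Groebner_Basis.algebra
  then show False using nz neq by (simp add: B_def)
qed

lemma ratio_in_F:
  assumes "y1 * \<sigma> y2 = y2 * \<sigma> y1" "y2 \<noteq> 0"
  shows "y1 / y2 \<in> F"
  using assms by (simp add: F_def hom eq_0_iff field_simps)

lemma coeff_sum_two:
  assumes F: "c1 \<in> F" "c2 \<in> F" and nz: "y1 \<noteq> 0" "y2 \<noteq> 0"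
    and lin: "c1 * y1 + c2 * y2 = 0"
    and quad: "c1 * adj y1 + c2 * adj y2 = 0"
  shows "c1 + c2 = 0"
proof (cases "c1 = 0")
  case True
  then show ?thesis using lin nz by simp
next
  case False
  define \<rho> where "\<rho> = y1 / y2"
  have y1: "y1 = \<rho> * y2" using nz by (simp add: \<rho>_def)
  have "\<rho> = - c2 / c1"
    using lin nz False by (simp add: \<rho>_def field_simps add_eq_0_iff)
  then have \<rho>: "\<rho> \<in> F" using F by (simp add: F_def hom)
  have "(c1 * \<rho> + c2) * y2 = 0" using lin y1 by Groebner_Basis.algebra
  then have 1: "c1 * \<rho> + c2 = 0" using nz by simp
  have "(c1 * \<rho> ^ 2 + c2) * adj y2 = 0"
    using quad by (simp add: y1 adj_mult adj_F[OF \<rho>] algebra_simps)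
  then have 2: "c1 * \<rho> ^ 2 + c2 = 0" using nz by (simp add: adj_eq_0_iff)
  have "c1 * (\<rho> * (\<rho> - 1)) = 0" using 1 2 by Groebner_Basis.algebra
  then have "\<rho> = 1" using False nz by (simp add: \<rho>_def)
  then show ?thesis using 1 by simp
qed

text \<open>By \<open>proportional\<close> the \<open>y\<close>'s are \<open>F\<close>-multiples of
  \<open>y3\<close>, on which the three relations become those for the first, second and third
  powers of scalars in \<open>F\<close>. A Vandermonde argument then gives the relation for the
  zeroth power.\<close>

lemma coeff_sum_three:
  assumes L: "y1 \<in> L" "y2 \<in> L" "y3 \<in> L" and F: "c1 \<in> F" "c2 \<in> F" "c3 \<in> F"
    and nz: "y1 \<noteq> 0" "y2 \<noteq> 0" "y3 \<noteq> 0"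
    and lin: "c1 * y1 + c2 * y2 + c3 * y3 = 0"
    and quad: "c1 * adj y1 + c2 * adj y2 + c3 * adj y3 = 0"
    and cub: "c1 * nrm y1 + c2 * nrm y2 + c3 * nrm y3 = 0"
  shows "c1 + c2 + c3 = 0"
proof -
  consider "c1 = 0" | "c2 = 0" | "c3 = 0" | "c1 \<noteq> 0" "c2 \<noteq> 0" "c3 \<noteq> 0" by blast
  then show ?thesis
  proof cases
    case 1
    then show ?thesis using coeff_sum_two[of c2 c3 y2 y3] assms by simp
  next
    case 2
    then show ?thesis using coeff_sum_two[of c1 c3 y1 y3] assms by simp
  next
    case 3
    then show ?thesis using coeff_sum_two[of c1 c2 y1 y2] assms by simp
  next
    case 4
    define r1 r2 where "r1 = y1 / y3" and "r2 = y2 / y3"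
    have "y1 * \<sigma> y3 = y3 * \<sigma> y1"
      using lin quad by (intro proportional[OF L(1,3,2) F(1,3,2)] 4) (simp_all add: algebra_simps)
    then have r1: "r1 \<in> F" unfolding r1_def using nz by (intro ratio_in_F)
    have "y2 * \<sigma> y3 = y3 * \<sigma> y2"
      using lin quad by (intro proportional[OF L(2,3,1) F(2,3,1)] 4) (simp_all add: algebra_simps)
    then have r2: "r2 \<in> F" unfolding r2_def using nz by (intro ratio_in_F)
    have y: "y1 = r1 * y3" "y2 = r2 * y3" using nz by (simp_all add: r1_def r2_def)
    have "(c1 * r1 + c2 * r2 + c3) * y3 = 0" using lin y by Groebner_Basis.algebra
    then have 1: "c1 * r1 + c2 * r2 + c3 = 0" using nz by simp
    have "(c1 * r1 ^ 2 + c2 * r2 ^ 2 + c3) * adj y3 = 0"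
      using quad by (simp add: y adj_mult adj_F r1 r2 algebra_simps)
    then have 2: "c1 * r1 ^ 2 + c2 * r2 ^ 2 + c3 = 0" using nz by (simp add: adj_eq_0_iff)
    have "(c1 * r1 ^ 3 + c2 * r2 ^ 3 + c3) * nrm y3 = 0"
      using cub by (simp add: y nrm_mult nrm_F r1 r2 algebra_simps)
    then have 3: "c1 * r1 ^ 3 + c2 * r2 ^ 3 + c3 = 0" using nz by (simp add: nrm_eq_0_iff)
    \<comment> \<open>Evaluate \<open>(X - r1) (X - r2) (X - 1)\<close>, with constant term \<open>- r1 r2\<close>, at \<open>r1\<close>, \<open>r2\<close>, \<open>1\<close>.\<close>
    have "r1 * r2 * (c1 + c2 + c3) = 0" using 1 2 3 by Groebner_Basis.algebra
    then show ?thesis using nz by (simp add: r1_def r2_def)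
  qed
qed

text \<open>Translating \<open>t1\<close> to 0 removes its term, and \<open>coeff_sum_three\<close>
  applies to the others. Only \<open>t1\<close> has to differ from the rest: \<open>t2\<close>,
  \<open>t3\<close>, \<open>t4\<close> may coincide, so shorter relations can be padded.\<close>

lemma isolated_coeff_zero:
  assumes L: "t1 \<in> L" "t2 \<in> L" "t3 \<in> L" "t4 \<in> L"
    and F: "c1 \<in> F" "c2 \<in> F" "c3 \<in> F" "c4 \<in> F"
    and neq: "t1 \<noteq> t2" "t1 \<noteq> t3" "t1 \<noteq> t4"
    and sum: "c1 + c2 + c3 + c4 = 0"
    and lin: "c1 * t1 + c2 * t2 + c3 * t3 + c4 * t4 = 0"
    and quad: "c1 * adj t1 + c2 * adj t2 + c3 * adj t3 + c4 * adj t4 = 0"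
    and cub: "c1 * nrm t1 + c2 * nrm t2 + c3 * nrm t3 + c4 * nrm t4 = 0"
  shows "c1 = 0"
proof -
  note s = sigma_F[OF F(1)] sigma_F[OF F(2)] sigma_F[OF F(3)] sigma_F[OF F(4)]
  have lin1: "c1 * \<sigma> t1 + c2 * \<sigma> t2 + c3 * \<sigma> t3 + c4 * \<sigma> t4 = 0"
    using arg_cong[OF lin, of \<sigma>] by (simp add: hom s)
  have lin2: "c1 * \<sigma> (\<sigma> t1) + c2 * \<sigma> (\<sigma> t2) + c3 * \<sigma> (\<sigma> t3) + c4 * \<sigma> (\<sigma> t4) = 0"
    using arg_cong[OF lin1, of \<sigma>] by (simp add: hom s)
  \<comment> \<open>\<open>nrm (t - t1)\<close> expands into products of conjugates, so translating
    the cubic relation uses all conjugates of the linear and quadratic ones.\<close>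
  have quad1: "c1 * (\<sigma> (\<sigma> t1) * \<sigma> (\<sigma> (\<sigma> t1))) + c2 * (\<sigma> (\<sigma> t2) * \<sigma> (\<sigma> (\<sigma> t2)))
     + c3 * (\<sigma> (\<sigma> t3) * \<sigma> (\<sigma> (\<sigma> t3))) + c4 * (\<sigma> (\<sigma> t4) * \<sigma> (\<sigma> (\<sigma> t4))) = 0"
    using arg_cong[OF quad, of \<sigma>] by (simp add: hom s adj_def)
  then have quad1: "c1 * (\<sigma> (\<sigma> t1) * t1) + c2 * (\<sigma> (\<sigma> t2) * t2)
     + c3 * (\<sigma> (\<sigma> t3) * t3) + c4 * (\<sigma> (\<sigma> t4) * t4) = 0"
    using L by (simp add: sigma_L)
  have quad2: "c1 * (\<sigma> (\<sigma> (\<sigma> t1)) * \<sigma> t1) + c2 * (\<sigma> (\<sigma> (\<sigma> t2)) * \<sigma> t2)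
     + c3 * (\<sigma> (\<sigma> (\<sigma> t3)) * \<sigma> t3) + c4 * (\<sigma> (\<sigma> (\<sigma> t4)) * \<sigma> t4) = 0"
    using arg_cong[OF quad1, of \<sigma>] by (simp add: hom s)
  then have quad2: "c1 * (t1 * \<sigma> t1) + c2 * (t2 * \<sigma> t2) + c3 * (t3 * \<sigma> t3) + c4 * (t4 * \<sigma> t4) = 0"
    using L by (simp add: sigma_L)
  have "c2 + c3 + c4 = 0"
  proof (rule coeff_sum_three[of "t2 - t1" "t3 - t1" "t4 - t1"])
    show "c2 * (t2 - t1) + c3 * (t3 - t1) + c4 * (t4 - t1) = 0"
      using sum lin by Groebner_Basis.algebra
    show "c2 * adj (t2 - t1) + c3 * adj (t3 - t1) + c4 * adj (t4 - t1) = 0"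
      using sum lin1 lin2 quad unfolding adj_def diff by Groebner_Basis.algebra
    show "c2 * nrm (t2 - t1) + c3 * nrm (t3 - t1) + c4 * nrm (t4 - t1) = 0"
      using sum lin lin1 lin2 quad quad1 quad2 cub unfolding nrm_def adj_def diff by Groebner_Basis.algebra
  qed (use L F neq in \<open>auto intro: L_closed\<close>)
  then show ?thesis using sum by (simp add: add.assoc)
qed


lemma pentagon:
  assumes L: "t1 \<in> L" "t2 \<in> L" "t3 \<in> L" "t4 \<in> L" "t5 \<in> L"
    and F: "c1 \<in> F" "c2 \<in> F" "c3 \<in> F" "c4 \<in> F" "c5 \<in> F"
    and c_nz: "c1 \<noteq> 0" "c2 \<noteq> 0" "c3 \<noteq> 0"
    and dist: "distinct [t1, t2, t3, t4, t5]"
    and sum: "c1 + c2 + c3 + c4 + c5 = 0"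
    and lin: "c1 * t1 + c2 * t2 + c3 * t3 + c4 * t4 + c5 * t5 = 0"
    and quad: "c1 * adj t1 + c2 * adj t2 + c3 * adj t3 + c4 * adj t4 + c5 * adj t5 = 0"
    and cub: "c1 * nrm t1 + c2 * nrm t2 + c3 * nrm t3 + c4 * nrm t4 + c5 * nrm t5 = 0"
    and center: "c1 * c2 * nrm (t2 - t1) + c1 * c3 * nrm (t3 - t1) + c1 * c4 * nrm (t4 - t1)
      + c1 * c5 * nrm (t5 - t1) + c2 * c3 * nrm (t3 - t2) + c2 * c4 * nrm (t4 - t2)
      + c2 * c5 * nrm (t5 - t2) + c3 * c4 * nrm (t4 - t3) + c3 * c5 * nrm (t5 - t3)
      + c4 * c5 * nrm (t5 - t4) = 0"
  shows False
proof -
  note s = sigma_F[OF F(1)] sigma_F[OF F(2)] sigma_F[OF F(3)] sigma_F[OF F(4)] sigma_F[OF F(5)]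
  have lin1: "c1 * \<sigma> t1 + c2 * \<sigma> t2 + c3 * \<sigma> t3 + c4 * \<sigma> t4 + c5 * \<sigma> t5 = 0"
    using arg_cong[OF lin, of \<sigma>] by (simp add: hom s)
  have lin2: "c1 * \<sigma> (\<sigma> t1) + c2 * \<sigma> (\<sigma> t2) + c3 * \<sigma> (\<sigma> t3) + c4 * \<sigma> (\<sigma> t4)
      + c5 * \<sigma> (\<sigma> t5) = 0"
    using arg_cong[OF lin1, of \<sigma>] by (simp add: hom s)
  have quad1: "c1 * (\<sigma> (\<sigma> t1) * t1) + c2 * (\<sigma> (\<sigma> t2) * t2)
     + c3 * (\<sigma> (\<sigma> t3) * t3) + c4 * (\<sigma> (\<sigma> t4) * t4) + c5 * (\<sigma> (\<sigma> t5) * t5) = 0"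
    using arg_cong[OF quad, of \<sigma>] L by (simp add: hom s adj_def sigma_L)
  have quad2: "c1 * (t1 * \<sigma> t1) + c2 * (t2 * \<sigma> t2) + c3 * (t3 * \<sigma> t3) + c4 * (t4 * \<sigma> t4)
      + c5 * (t5 * \<sigma> t5) = 0"
    using arg_cong[OF quad1, of \<sigma>] L by (simp add: hom s sigma_L)
  define y1 y2 y3 y4 where y: "y1 = t1 - t5" "y2 = t2 - t5" "y3 = t3 - t5" "y4 = t4 - t5"
  have yL: "y1 \<in> L" "y2 \<in> L" "y3 \<in> L" "y4 \<in> L" unfolding y by (intro L_closed L)+
  have y_nz: "y1 \<noteq> 0" "y2 \<noteq> 0" "y3 \<noteq> 0" "y4 \<noteq> 0" using dist by (auto simp: y)
  have ylin: "c1 * y1 + c2 * y2 + c3 * y3 + c4 * y4 = 0"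
    unfolding y using sum lin by Groebner_Basis.algebra
  have yquad: "c1 * adj y1 + c2 * adj y2 + c3 * adj y3 + c4 * adj y4 = 0"
    unfolding y using sum lin1 lin2 quad unfolding adj_def diff by Groebner_Basis.algebra
  have ycub: "c1 * nrm y1 + c2 * nrm y2 + c3 * nrm y3 + c4 * nrm y4 = 0"
    unfolding y using sum lin lin1 lin2 quad quad1 quad2 cub unfolding nrm_def adj_def diff by Groebner_Basis.algebra
  define s1 s2 s3 s4 where si: "s1 = 1 / y1" "s2 = 1 / y2" "s3 = 1 / y3" "s4 = 1 / y4"
  \<comment> \<open>Inversion reverses the coordinates of \<open>v(y)\<close> up to scale:
    \<open>nrm y * v(1 / y) = (nrm y, adj y, y, 1)\<close>. With these coefficients the cubic,
    quadratic and linear relations in \<open>y\<close> become the constant, linear and quadratic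
    ones in \<open>s\<close>. The direction \<open>t5\<close> has gone to infinity.\<close>
  define k1 k2 k3 k4 where k: "k1 = c1 * nrm y1" "k2 = c2 * nrm y2" "k3 = c3 * nrm y3" "k4 = c4 * nrm y4"
  have sL: "s1 \<in> L" "s2 \<in> L" "s3 \<in> L" "s4 \<in> L"
    unfolding si using F_subset_L F_closed(2) yL by (auto intro!: L_closed)
  have kF: "k1 \<in> F" "k2 \<in> F" "k3 \<in> F" "k4 \<in> F"
    unfolding k by (intro F_closed F nrm_in_F yL)+
  have k_nz: "k1 \<noteq> 0" "k2 \<noteq> 0" "k3 \<noteq> 0"
    using c_nz y_nz by (simp_all add: k nrm_eq_0_iff)
  have ksum: "k1 + k2 + k3 + k4 = 0" using ycub by (simp add: k)
  have inv: "nrm y * (1 / y) = adj y" "nrm y * adj (1 / y) = y" if "y \<noteq> 0" for y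
    using that by (simp_all add: nrm_def adj_def hom eq_0_iff)
  have klin: "k1 * s1 + k2 * s2 + k3 * s3 + k4 * s4 = 0"
    using yquad unfolding k si mult.assoc by (simp only: inv y_nz not_False_eq_True)
  have kquad: "k1 * adj s1 + k2 * adj s2 + k3 * adj s3 + k4 * adj s4 = 0"
    using ylin unfolding k si mult.assoc by (simp only: inv y_nz not_False_eq_True)
  have sk: "\<sigma> k1 = k1" "\<sigma> k2 = k2" "\<sigma> k3 = k3" "\<sigma> k4 = k4"
    using kF by (auto simp: sigma_F)
  have klin1: "k1 * \<sigma> s1 + k2 * \<sigma> s2 + k3 * \<sigma> s3 + k4 * \<sigma> s4 = 0"
    using arg_cong[OF klin, of \<sigma>] by (simp add: hom sk)
  have klin2: "k1 * \<sigma> (\<sigma> s1) + k2 * \<sigma> (\<sigma> s2) + k3 * \<sigma> (\<sigma> s3) + k4 * \<sigma> (\<sigma> s4) = 0"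
    using arg_cong[OF klin1, of \<sigma>] by (simp add: hom sk)
  define w1 w2 w3 where w: "w1 = s1 - s4" "w2 = s2 - s4" "w3 = s3 - s4"
  have wL: "w1 \<in> L" "w2 \<in> L" "w3 \<in> L" unfolding w by (intro L_closed sL)+
  have w_nz: "w1 \<noteq> 0" "w2 \<noteq> 0" "w3 \<noteq> 0" "w1 \<noteq> w2" "w1 \<noteq> w3" "w2 \<noteq> w3"
    using dist by (auto simp: w si y)
  have wlin: "k1 * w1 + k2 * w2 + k3 * w3 = 0"
    unfolding w using ksum klin by Groebner_Basis.algebra
  have wquad: "k1 * adj w1 + k2 * adj w2 + k3 * adj w3 = 0"
    unfolding w using ksum klin1 klin2 kquad unfolding adj_def diff by Groebner_Basis.algebra
  define r1 r2 where "r1 = w1 / w3" and "r2 = w2 / w3"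
  have r: "r1 \<in> F" "r2 \<in> F" unfolding r1_def r2_def
    using wlin wquad k_nz w_nz
    by (auto intro!: ratio_in_F proportional[OF wL(1,3,2) kF(1,3,2)]
        proportional[OF wL(2,3,1) kF(2,3,1)] simp: add_ac)
  have wr: "w1 = r1 * w3" "w2 = r2 * w3" using w_nz by (simp_all add: r1_def r2_def)
  have r_nz: "r1 \<noteq> 0" "r2 \<noteq> 0" "r1 \<noteq> 1" "r2 \<noteq> 1" "r1 \<noteq> r2"
    using w_nz by (auto simp: r1_def r2_def)
  have "(k1 * r1 + k2 * r2 + k3) * w3 = 0" using wlin wr by Groebner_Basis.algebra
  then have 1: "k1 * r1 + k2 * r2 + k3 = 0" using w_nz by simp
  have "(k1 * r1 ^ 2 + k2 * r2 ^ 2 + k3) * adj w3 = 0"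
    using wquad by (simp add: wr adj_mult adj_F r algebra_simps)
  then have 2: "k1 * r1 ^ 2 + k2 * r2 ^ 2 + k3 = 0" using w_nz by (simp add: adj_eq_0_iff)
  have nrm_swap: "nrm (y - x) = nrm x * nrm y * nrm (1 / x - 1 / y)" if "x \<noteq> 0" "y \<noteq> 0" for x y
  proof -
    have "y - x = x * y * (1 / x - 1 / y)" using that by (simp add: field_simps)
    then show ?thesis by (metis nrm_mult)
  qed
  have nrm_neg: "nrm (- x) = - nrm x" for x by (simp add: nrm_def adj_def hom)
  have t: "t2 - t1 = y2 - y1" "t3 - t1 = y3 - y1" "t4 - t1 = y4 - y1" "t3 - t2 = y3 - y2"
    "t4 - t2 = y4 - y2" "t4 - t3 = y4 - y3" "t5 - t1 = - y1" "t5 - t2 = - y2" "t5 - t3 = - y3"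
    "t5 - t4 = - y4" by (simp_all add: y)
  have s: "1 / y1 - 1 / y2 = w1 - w2" "1 / y1 - 1 / y3 = w1 - w3" "1 / y1 - 1 / y4 = w1"
    "1 / y2 - 1 / y3 = w2 - w3" "1 / y2 - 1 / y4 = w2" "1 / y3 - 1 / y4 = w3"
    by (simp_all add: w si)
  \<comment> \<open>Each \<open>c_i * c_j * nrm (t_j - t_i)\<close> with \<open>i, j\<close> below 5
    becomes \<open>k_i * k_j * nrm (s_i - s_j)\<close> by \<open>nrm_swap\<close>. The terms with
    \<open>c5\<close> add up to \<open>- c5 * (k1 + k2 + k3 + k4)\<close>, which vanishes by
    \<open>ycub\<close>.\<close>
  have "k1 * k2 * nrm (w1 - w2) + k1 * k3 * nrm (w1 - w3) + k1 * k4 * nrm w1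
      + k2 * k3 * nrm (w2 - w3) + k2 * k4 * nrm w2 + k3 * k4 * nrm w3 = 0"
    using center ycub unfolding t k nrm_neg
    by (simp only: nrm_swap y_nz not_False_eq_True s) Groebner_Basis.algebra
  moreover have "w1 - w2 = (r1 - r2) * w3" "w1 - w3 = (r1 - 1) * w3" "w2 - w3 = (r2 - 1) * w3"
    by (simp_all add: wr algebra_simps)
  ultimately have "(k1 * k2 * (r1 - r2) ^ 3 + k1 * k3 * (r1 - 1) ^ 3 + k1 * k4 * r1 ^ 3
      + k2 * k3 * (r2 - 1) ^ 3 + k2 * k4 * r2 ^ 3 + k3 * k4) * nrm w3 = 0"
    using r by (simp add: wr nrm_mult nrm_F F_closed) Groebner_Basis.algebra
  then have 3: "k1 * k2 * (r1 - r2) ^ 3 + k1 * k3 * (r1 - 1) ^ 3 + k1 * k4 * r1 ^ 3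
      + k2 * k3 * (r2 - 1) ^ 3 + k2 * k4 * r2 ^ 3 + k3 * k4 = 0"
    using w_nz by (simp add: nrm_eq_0_iff)
  \<comment> \<open>Relations \<open>1\<close> and \<open>2\<close> determine
    \<open>(k1, k2, k3)\<close> up to a scalar, as the cross product of \<open>(r1, r2, 1)\<close>
    and \<open>(r1^2, r2^2, 1)\<close>; \<open>c\<close> is that scalar, up to sign.\<close>
  define c where "c = k1 / (r2 * (r2 - 1))"
  have k1: "k1 = c * (r2 * (r2 - 1))" using r_nz by (simp add: c_def)
  have "(k2 + c * (r1 * (r1 - 1))) * (r2 * (r2 - 1)) = 0"
    using 1 2 k1 by Groebner_Basis.algebra
  then have k2: "k2 = - c * (r1 * (r1 - 1))" using r_nz by (simp add: add_eq_0_iff)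
  have k3: "k3 = c * (r1 * r2 * (r1 - r2))" using 1 k1 k2 by Groebner_Basis.algebra
  have k4: "k4 = - (k1 + k2 + k3)" using ksum by Groebner_Basis.algebra
  \<comment> \<open>Substituting this solution into \<open>3\<close> yields a vanishing product of
    nonzero factors; the factor 2 is where odd characteristic enters.\<close>
  have "2 * (c * (r2 - 1) * (r1 - r2)) ^ 2 * (r1 * r2 * (r1 - 1)) = 0"
    using 3 unfolding k4 k3 k2 k1 by Groebner_Basis.algebra
  then show False using k_nz r_nz two_neq_zero by (simp add: k1)
qed

end

subsection \<open>The hypergraphs\<close>

text \<open>The last coordinate of a vertex ranges over \<open>Z\<close>. With \<open>Z = {0}\<close> and \<open>\<epsilon> = 0\<close> it carries no
  information; with \<open>Z = F\<close> and \<open>\<epsilon> = 1\<close> it is the centre of the Heisenberg extension.\<close>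

locale hexagon_hypergraph = order_three_endomorphism \<sigma> for \<sigma> :: "'a::field \<Rightarrow> 'a" +
  fixes S Z :: "'a set" and \<epsilon> :: 'a
  assumes S_subset_F: "S \<subseteq> F"
    and Sidon: "a \<in> S \<Longrightarrow> b \<in> S \<Longrightarrow> c \<in> S \<Longrightarrow> d \<in> S \<Longrightarrow> a + c = b + d \<Longrightarrow> a = b \<or> a = d"
    and finite_S: "finite S"
    and card_S: "2 \<le> card S"
    and finite_L: "finite L"
    and finite_Z: "finite Z"
    and Z_closed: "z \<in> Z \<Longrightarrow> c \<in> F \<Longrightarrow> z + \<epsilon> * c \<in> Z"
begin

text \<open>\<open>form a x y b t\<close> is the value of the alternating form
  \<open>\<omega>((a, x, y, b), (a', x', y', b')) = a b' - tr (x y') + tr (y x') - b a'\<close>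
  at \<open>(a, x, y, b)\<close> and \<open>(1, t, adj t, nrm t)\<close>.\<close>

definition form :: "'a \<Rightarrow> 'a \<Rightarrow> 'a \<Rightarrow> 'a \<Rightarrow> 'a \<Rightarrow> 'a" where
  "form a x y b t = a * nrm t - tr (x * adj t) + tr (y * t) - b"

text \<open>\<open>(x, y, b, z)\<close> is the position of the line at first coordinate 0, which
  need not belong to \<open>S\<close>, and \<open>t\<close> gives the direction. The last coordinate
  has slope \<open>\<omega>\<close> of the position and \<open>v(t)\<close>, as for a one-parameter
  subgroup translated in the Heisenberg group.\<close>

definition point :: "'a \<times> 'a \<times> 'a \<times> 'a \<times> 'a \<Rightarrow> 'a \<Rightarrow> 'a \<times> 'a \<times> 'a \<times> 'a \<times> 'a" where
  "point = (\<lambda>(x, y, b, z, t) a.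
     (a, x + a * t, y + a * adj t, b + a * nrm t, z + \<epsilon> * (a * form 0 x y b t)))"

definition edge :: "'a \<times> 'a \<times> 'a \<times> 'a \<times> 'a \<Rightarrow> ('a \<times> 'a \<times> 'a \<times> 'a \<times> 'a) set" where
  "edge p = point p ` S"

definition params :: "('a \<times> 'a \<times> 'a \<times> 'a \<times> 'a) set" where
  "params = L \<times> L \<times> F \<times> Z \<times> L"

definition vertices :: "('a \<times> 'a \<times> 'a \<times> 'a \<times> 'a) set" where
  "vertices = S \<times> L \<times> L \<times> F \<times> Z"

definition hyperedges :: "('a \<times> 'a \<times> 'a \<times> 'a \<times> 'a) set set" where
  "hyperedges = edge ` params"

text \<open>This keeps only what is needed of two points on a common edge. The form is evaluated at
  the starting point instead of at first coordinate 0; it is constant along a line.\<close>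

definition step :: "'a \<Rightarrow> 'a \<times> 'a \<times> 'a \<times> 'a \<times> 'a \<Rightarrow> 'a \<times> 'a \<times> 'a \<times> 'a \<times> 'a \<Rightarrow> bool" where
  "step t = (\<lambda>(a, x, y, b, z) (a', x', y', b', z').
     a \<in> S \<and> a' \<in> S \<and> a \<noteq> a' \<and> t \<in> L \<and>
     x' = x + (a' - a) * t \<and> y' = y + (a' - a) * adj t \<and> b' = b + (a' - a) * nrm t \<and>
     z' = z + \<epsilon> * ((a' - a) * form a x y b t))"

lemma step_mem: "step t (a, x, y, b, z) (a', x', y', b', z') \<Longrightarrow> a \<in> S"
  and step_neq: "step t (a, x, y, b, z) (a', x', y', b', z') \<Longrightarrow> a' - a \<noteq> 0"
  and step_dir: "step t (a, x, y, b, z) (a', x', y', b', z') \<Longrightarrow> t \<in> L"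
  and step_diff: "step t (a, x, y, b, z) (a', x', y', b', z') \<Longrightarrow> a' - a \<in> F"
  and step_rel:
    "step t (a, x, y, b, z) (a', x', y', b', z') \<Longrightarrow> (a' - a) * t = x' - x"
    "step t (a, x, y, b, z) (a', x', y', b', z') \<Longrightarrow> (a' - a) * adj t = y' - y"
    "step t (a, x, y, b, z) (a', x', y', b', z') \<Longrightarrow> (a' - a) * nrm t = b' - b"
    "step t (a, x, y, b, z) (a', x', y', b', z') \<Longrightarrow> \<epsilon> * ((a' - a) * form a x y b t) = z' - z"
  using S_subset_F by (auto simp: step_def intro!: F_closed)

section \<open>The alternating form along lines\<close>

lemma tr_add: "tr (x + y) = tr x + tr y"
  and tr_zero: "tr 0 = 0"
  by (simp_all add: tr_def hom)

lemma tr_scale: "c \<in> F \<Longrightarrow> tr (c * x) = c * tr x"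
  by (simp add: tr_def hom sigma_F algebra_simps)

text \<open>This is linearity of \<open>\<omega>\<close> in its first argument together with
  \<open>\<omega>(v(s), v(t)) = nrm (t - s)\<close>. For \<open>s = t\<close> it says that the form
  is constant along a line.\<close>

lemma form_shift:
  assumes "c \<in> F" "s \<in> L" "t \<in> L"
  shows "form (a + c) (x + c * s) (y + c * adj s) (b + c * nrm s) t
    = form a x y b t + c * nrm (t - s)"
proof -
  have "tr ((x + c * s) * adj t) = tr (x * adj t) + c * tr (s * adj t)"
    "tr ((y + c * adj s) * t) = tr (y * t) + c * tr (adj s * t)"
    using assms by (simp_all add: distrib_right tr_add mult.assoc tr_scale)
  moreover have "nrm (t - s) = nrm t - tr (s * adj t) + tr (adj s * t) - nrm s"
    using assms by (simp add: nrm_def adj_def tr_def hom sigma_L algebra_simps)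
  ultimately show ?thesis unfolding form_def by Groebner_Basis.algebra
qed

lemma point_step:
  assumes "p \<in> params" "a \<in> S" "a' \<in> S" "a \<noteq> a'"
  shows "step (snd (snd (snd (snd p)))) (point p a) (point p a')"
proof -
  obtain x y b z t where p: "p = (x, y, b, z, t)" by (cases p) auto
  have mem: "t \<in> L" "a \<in> F" using assms S_subset_F by (auto simp: p params_def)
  have "form a (x + a * t) (y + a * adj t) (b + a * nrm t) t = form 0 x y b t"
    using form_shift[OF mem(2) mem(1) mem(1), of 0 x y b] by (simp add: nrm_def)
  then show ?thesis using assms mem by (simp add: p step_def point_def algebra_simps)
qed

text \<open>Hence two different edges through a common vertex have different directions.\<close>

lemma point_determines_param:
  assumes "point p a = point p' a'" "snd (snd (snd (snd p))) = snd (snd (snd (snd p')))"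
  shows "p = p'"
proof -
  obtain x y b z t x' y' b' z' where p: "p = (x, y, b, z, t)" "p' = (x', y', b', z', t)"
    using assms(2) by (cases p, cases p') auto
  then have "a = a'" "x = x'" "y = y'" "b = b'" using assms(1) by (auto simp: point_def)
  then show ?thesis using assms(1) by (simp add: p point_def)
qed

text \<open>The first coordinate labels the points of an edge, so equal edges agree point by point,
  and two of these points fix the direction.\<close>

lemma inj_edge: "inj_on edge params"
proof (rule inj_onI)
  fix p p' assume p: "p \<in> params" "p' \<in> params" and eq: "edge p = edge p'"
  obtain x y b z t x' y' b' z' t' where pp: "p = (x, y, b, z, t)" "p' = (x', y', b', z', t')"
    by (cases p, cases p') auto
  obtain a a' where a: "a \<in> S" "a' \<in> S" "a \<noteq> a'"
    using card_S by (metis card_le_Suc0_iff_eq finite_S not_less_eq_eq numeral_2_eq_2)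
  have pts: "point p c = point p' c" if "c \<in> S" for c
  proof -
    have "point p c \<in> edge p'" using that eq by (auto simp: edge_def)
    then show ?thesis by (auto simp: edge_def point_def pp)
  qed
  have "a * t - a' * t = a * t' - a' * t'"
    using pts[OF a(1)] pts[OF a(2)] by (simp add: pp point_def) Groebner_Basis.algebra
  then have "(a - a') * (t - t') = 0" by (simp add: algebra_simps)
  then have "t = t'" using a by simp
  then show "p = p'"
    by (intro point_determines_param[OF pts[OF a(1)]]) (simp add: pp)
qed

lemma finite_F: "finite F"
  using finite_L F_subset_L by (rule rev_finite_subset)

lemma uniform: "uniform_hypergraph (card S) vertices hyperedges"
  unfolding uniform_hypergraph_def
proof (intro conjI ballI)
  show "finite vertices"
    by (simp add: vertices_def finite_S finite_L finite_F finite_Z)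
  fix e assume "e \<in> hyperedges"
  then obtain x y b z t where e: "e = edge (x, y, b, z, t)"
    and mem: "x \<in> L" "y \<in> L" "b \<in> F" "z \<in> Z" "t \<in> L"
    by (auto simp: hyperedges_def params_def)
  have "point (x, y, b, z, t) a \<in> vertices" if "a \<in> S" for a
  proof -
    have a: "a \<in> F" "a \<in> L" using that S_subset_F F_subset_L by auto
    have "a * form 0 x y b t \<in> F"
      unfolding form_def using mem a
      by (auto intro!: F_closed tr_in_F nrm_in_F L_closed)
    then show ?thesis
      using that mem a by (auto simp: vertices_def point_def intro!: Z_closed L_closed F_closed nrm_in_F)
  qed
  then show "e \<subseteq> vertices" by (auto simp: e edge_def)
  have "inj_on (point (x, y, b, z, t)) S" by (auto simp: inj_on_def point_def)
  then show "card e = card S" by (simp add: e edge_def card_image)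
qed

lemma card_vertices: "card vertices = card S * card L ^ 2 * card F * card Z"
  by (simp add: vertices_def card_cartesian_product power2_eq_square)

lemma card_hyperedges: "card hyperedges = card L ^ 3 * card F * card Z"
  using card_image[OF inj_edge]
  by (simp add: hyperedges_def params_def card_cartesian_product power3_eq_cube mult_ac)

section \<open>Closed walks of lengths 2 to 5\<close>

lemma step_closes:
  assumes "step t1 P Q" "step t2 Q P" "t1 \<noteq> t2"
  shows False
proof -
  obtain a1 x1 y1 b1 z1 a2 x2 y2 b2 z2 where PQ: "P = (a1, x1, y1, b1, z1)" "Q = (a2, x2, y2, b2, z2)"
    by (cases P, cases Q) auto
  note st = assms(1,2)[unfolded PQ]
  have "(a2 - a1) * (t1 - t2) = (a2 - a1) * t1 + (a1 - a2) * t2" by (simp add: algebra_simps)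
  also have "\<dots> = 0" unfolding st[THEN step_rel(1)] by simp
  finally show False using step_neq[OF st(1)] assms(3) by simp
qed

lemma no_triangle:
  assumes st: "step t1 P1 P2" "step t2 P2 P3" "step t3 P3 P1"
    and t: "t1 \<noteq> t2" "t2 \<noteq> t3" "t3 \<noteq> t1"
  shows False
proof -
  obtain a1 x1 y1 b1 z1 where P1: "P1 = (a1, x1, y1, b1, z1)" by (cases P1)
  obtain a2 x2 y2 b2 z2 where P2: "P2 = (a2, x2, y2, b2, z2)" by (cases P2)
  obtain a3 x3 y3 b3 z3 where P3: "P3 = (a3, x3, y3, b3, z3)" by (cases P3)
  note s = st[unfolded P1 P2 P3]
  have "a2 - a1 = 0"
  \<comment> \<open>The fourth direction is a repetition of \<open>t3\<close> with coefficient
    0.\<close>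
  proof (rule isolated_coeff_zero[of t1 t2 t3 t3 _ "a3 - a2" "a1 - a3" 0])
    show "(a2 - a1) * t1 + (a3 - a2) * t2 + (a1 - a3) * t3 + 0 * t3 = 0"
      "(a2 - a1) * adj t1 + (a3 - a2) * adj t2 + (a1 - a3) * adj t3 + 0 * adj t3 = 0"
      "(a2 - a1) * nrm t1 + (a3 - a2) * nrm t2 + (a1 - a3) * nrm t3 + 0 * nrm t3 = 0"
      unfolding s[THEN step_rel(1)] s[THEN step_rel(2)] s[THEN step_rel(3)] by simp_all
  qed (use t s[THEN step_dir] s[THEN step_diff] F_closed in auto)
  then show False using step_neq[OF s(1)] by simp
qed

text \<open>A direction differing from the other three would have coefficient 0, so opposite sides
  are parallel. The resulting parallelogram gives an additive coincidence in \<open>S\<close>, which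
  the Sidon property excludes.\<close>

lemma no_quadrangle:
  assumes st: "step t1 P1 P2" "step t2 P2 P3" "step t3 P3 P4" "step t4 P4 P1"
    and t: "t1 \<noteq> t2" "t2 \<noteq> t3" "t3 \<noteq> t4" "t4 \<noteq> t1"
  shows False
proof -
  obtain a1 x1 y1 b1 z1 where P1: "P1 = (a1, x1, y1, b1, z1)" by (cases P1)
  obtain a2 x2 y2 b2 z2 where P2: "P2 = (a2, x2, y2, b2, z2)" by (cases P2)
  obtain a3 x3 y3 b3 z3 where P3: "P3 = (a3, x3, y3, b3, z3)" by (cases P3)
  obtain a4 x4 y4 b4 z4 where P4: "P4 = (a4, x4, y4, b4, z4)" by (cases P4)
  note s = st[unfolded P1 P2 P3 P4]
  have rel: "(a2 - a1) * t1 + (a3 - a2) * t2 + (a4 - a3) * t3 + (a1 - a4) * t4 = 0"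
    "(a2 - a1) * adj t1 + (a3 - a2) * adj t2 + (a4 - a3) * adj t3 + (a1 - a4) * adj t4 = 0"
    "(a2 - a1) * nrm t1 + (a3 - a2) * nrm t2 + (a4 - a3) * nrm t3 + (a1 - a4) * nrm t4 = 0"
    unfolding s[THEN step_rel(1)] s[THEN step_rel(2)] s[THEN step_rel(3)] by simp_all
  note dir = s[THEN step_dir] and diff = s[THEN step_diff]
  have 1: "t1 = t3"
  proof (rule ccontr)
    assume "t1 \<noteq> t3"
    then have "a2 - a1 = 0"
      using t rel
      by (intro isolated_coeff_zero[OF dir diff]) auto
    then show False using step_neq[OF s(1)] by simp
  qed
  have 2: "t2 = t4"
  proof (rule ccontr)
    assume "t2 \<noteq> t4"
    then have "a3 - a2 = 0"
      using t rel
      by (intro isolated_coeff_zero[OF dir(2,1,3,4) diff(2,1,3,4)]) (auto simp: algebra_simps)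
    then show False using step_neq[OF s(2)] by simp
  qed
  have "(a2 - a1) + (a4 - a3) = 0"
  proof (rule isolated_coeff_zero[of t1 t2 t2 t2 _ "(a3 - a2) + (a1 - a4)" 0 0])
    show "(a2 - a1 + (a4 - a3)) * t1 + (a3 - a2 + (a1 - a4)) * t2 + 0 * t2 + 0 * t2 = 0"
      "(a2 - a1 + (a4 - a3)) * adj t1 + (a3 - a2 + (a1 - a4)) * adj t2 + 0 * adj t2 + 0 * adj t2 = 0"
      "(a2 - a1 + (a4 - a3)) * nrm t1 + (a3 - a2 + (a1 - a4)) * nrm t2 + 0 * nrm t2 + 0 * nrm t2 = 0"
      using rel unfolding 1[symmetric] 2[symmetric] by Groebner_Basis.algebra+
  qed (use t dir diff F_closed in auto)
  then have "a2 + a4 = a1 + a3" by (simp add: algebra_simps)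
  then show False using Sidon[OF s(2,1,4,3)[THEN step_mem]] step_neq[OF s(1)] step_neq[OF s(2)] by simp
qed


text \<open>The case of equal first and third directions. Their coefficients merge into
  \<open>c1 + c3\<close>, which may vanish, so the contradiction has to come from another direction:
  \<open>t2\<close> is isolated, or it equals one of \<open>t4\<close>, \<open>t5\<close> and the
  other one is.\<close>

lemma pentagon_repeat:
  assumes L: "t1 \<in> L" "t2 \<in> L" "t4 \<in> L" "t5 \<in> L"
    and F: "c1 \<in> F" "c2 \<in> F" "c3 \<in> F" "c4 \<in> F" "c5 \<in> F"
    and nz: "c2 \<noteq> 0" "c4 \<noteq> 0" "c5 \<noteq> 0"
    and t: "t1 \<noteq> t2" "t1 \<noteq> t4" "t4 \<noteq> t5" "t5 \<noteq> t1"
    and sum: "c1 + c2 + c3 + c4 + c5 = 0"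
    and lin: "c1 * t1 + c2 * t2 + c3 * t1 + c4 * t4 + c5 * t5 = 0"
    and quad: "c1 * adj t1 + c2 * adj t2 + c3 * adj t1 + c4 * adj t4 + c5 * adj t5 = 0"
    and cub: "c1 * nrm t1 + c2 * nrm t2 + c3 * nrm t1 + c4 * nrm t4 + c5 * nrm t5 = 0"
  shows False
proof -
  have F': "c1 + c3 \<in> F" using F by (intro F_closed)
  note isolated = isolated_coeff_zero[OF _ _ _ _ _ _ _ F']
  consider "t2 \<noteq> t4" "t2 \<noteq> t5" | "t2 = t4" | "t2 = t5" by blast
  then show False
  proof cases
    case 1
    have "c2 = 0"
      by (rule isolated[of t2 t4 t5 t1 c2 c4 c5])
        (use L F t 1 sum lin quad cub in \<open>simp_all add: algebra_simps\<close>)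
    then show False using nz by simp
  next
    case 2
    have "c5 = 0"
      by (rule isolated[of t5 t4 t2 t1 c5 c4 c2])
        (use L F t 2 sum lin quad cub in \<open>simp_all add: algebra_simps\<close>)
    then show False using nz by simp
  next
    case 3
    have "c4 = 0"
      by (rule isolated[of t4 t5 t2 t1 c4 c5 c2])
        (use L F t 3 sum lin quad cub in \<open>simp_all add: algebra_simps\<close>)
    then show False using nz by simp
  qed
qed

lemma no_pentagon:
  assumes st: "step t1 P1 P2" "step t2 P2 P3" "step t3 P3 P4" "step t4 P4 P5" "step t5 P5 P1"
    and t: "t1 \<noteq> t2" "t2 \<noteq> t3" "t3 \<noteq> t4" "t4 \<noteq> t5" "t5 \<noteq> t1"
    and \<epsilon>: "\<epsilon> = 1"
  shows False
proof -
  obtain a1 x1 y1 b1 z1 where P1: "P1 = (a1, x1, y1, b1, z1)" by (cases P1)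
  obtain a2 x2 y2 b2 z2 where P2: "P2 = (a2, x2, y2, b2, z2)" by (cases P2)
  obtain a3 x3 y3 b3 z3 where P3: "P3 = (a3, x3, y3, b3, z3)" by (cases P3)
  obtain a4 x4 y4 b4 z4 where P4: "P4 = (a4, x4, y4, b4, z4)" by (cases P4)
  obtain a5 x5 y5 b5 z5 where P5: "P5 = (a5, x5, y5, b5, z5)" by (cases P5)
  note s = st[unfolded P1 P2 P3 P4 P5]
  define c1 c2 c3 c4 c5 where
    c: "c1 = a2 - a1" "c2 = a3 - a2" "c3 = a4 - a3" "c4 = a5 - a4" "c5 = a1 - a5"
  note dir = s[THEN step_dir] and cF = s[THEN step_diff, folded c]
    and c_nz = s[THEN step_neq, folded c]
  have sum: "c1 + c2 + c3 + c4 + c5 = 0" by (simp add: c)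
  have rel: "c1 * t1 + c2 * t2 + c3 * t3 + c4 * t4 + c5 * t5 = 0"
    "c1 * adj t1 + c2 * adj t2 + c3 * adj t3 + c4 * adj t4 + c5 * adj t5 = 0"
    "c1 * nrm t1 + c2 * nrm t2 + c3 * nrm t3 + c4 * nrm t4 + c5 * nrm t5 = 0"
    unfolding c s[THEN step_rel(1)] s[THEN step_rel(2)] s[THEN step_rel(3)] by simp_all
  \<comment> \<open>Neighbouring directions differ by assumption; the five other coincidences are
    rotations of \<open>pentagon_repeat\<close>.\<close>
  have dist: "distinct [t1, t2, t3, t4, t5]"
  proof (rule ccontr)
    assume "\<not> ?thesis"
    then consider "t3 = t1" | "t4 = t2" | "t5 = t3" | "t1 = t4" | "t2 = t5" using t by auto
    then show False
    proof cases
      case 1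
      show False
        by (rule pentagon_repeat[OF dir(1,2,4,5) cF])
          (use 1 t c_nz sum rel in \<open>auto simp: add_ac\<close>)
    next
      case 2
      show False
        by (rule pentagon_repeat[OF dir(2,3,5,1) cF(2,3,4,5,1)])
          (use 2 t c_nz sum rel in \<open>auto simp: add_ac\<close>)
    next
      case 3
      show False
        by (rule pentagon_repeat[OF dir(3,4,1,2) cF(3,4,5,1,2)])
          (use 3 t c_nz sum rel in \<open>auto simp: add_ac\<close>)
    next
      case 4
      show False
        by (rule pentagon_repeat[OF dir(4,5,2,3) cF(4,5,1,2,3)])
          (use 4 t c_nz sum rel in \<open>auto simp: add_ac\<close>)
    next
      case 5
      show False
        by (rule pentagon_repeat[OF dir(5,1,3,4) cF(5,1,2,3,4)])
          (use 5 t c_nz sum rel in \<open>auto simp: add_ac\<close>)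
    qed
  qed
  define f where "f = form a1 x1 y1 b1"
  have next_pt: "a2 = a1 + c1" "a3 = a2 + c2" "a4 = a3 + c3" "a5 = a4 + c4"
    "x2 = x1 + c1 * t1" "x3 = x2 + c2 * t2" "x4 = x3 + c3 * t3" "x5 = x4 + c4 * t4"
    "y2 = y1 + c1 * adj t1" "y3 = y2 + c2 * adj t2" "y4 = y3 + c3 * adj t3" "y5 = y4 + c4 * adj t4"
    "b2 = b1 + c1 * nrm t1" "b3 = b2 + c2 * nrm t2" "b4 = b3 + c3 * nrm t3" "b5 = b4 + c4 * nrm t4"
    unfolding c s[THEN step_rel(1)] s[THEN step_rel(2)] s[THEN step_rel(3)] by simp_all
  have f2: "form a2 x2 y2 b2 t = f t + c1 * nrm (t - t1)" if "t \<in> L" for t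
    unfolding next_pt(1,5,9,13) f_def by (rule form_shift[OF cF(1) dir(1) that])
  have f3: "form a3 x3 y3 b3 t = form a2 x2 y2 b2 t + c2 * nrm (t - t2)" if "t \<in> L" for t
    unfolding next_pt(2,6,10,14) by (rule form_shift[OF cF(2) dir(2) that])
  have f4: "form a4 x4 y4 b4 t = form a3 x3 y3 b3 t + c3 * nrm (t - t3)" if "t \<in> L" for t
    unfolding next_pt(3,7,11,15) by (rule form_shift[OF cF(3) dir(3) that])
  have f5: "form a5 x5 y5 b5 t = form a4 x4 y4 b4 t + c4 * nrm (t - t4)" if "t \<in> L" for t
    unfolding next_pt(4,8,12,16) by (rule form_shift[OF cF(4) dir(4) that])
  have cf: "c * f t = a1 * (c * nrm t) - tr (x1 * (c * adj t)) + tr (y1 * (c * t)) - b1 * c"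
    if "c \<in> F" for c t
    using tr_scale[OF that, of "x1 * adj t"] tr_scale[OF that, of "y1 * t"]
    by (simp add: f_def form_def algebra_simps)
  \<comment> \<open>The left side is \<open>\<omega>\<close> of the first point and the sum of the
    \<open>c_i * v(t_i)\<close>, which is zero. So the closing condition on the last coordinate
    retains only the corrections from \<open>form_shift\<close>.\<close>
  have "c1 * f t1 + c2 * f t2 + c3 * f t3 + c4 * f t4 + c5 * f t5
      = a1 * (c1 * nrm t1 + c2 * nrm t2 + c3 * nrm t3 + c4 * nrm t4 + c5 * nrm t5)
       - tr (x1 * (c1 * adj t1 + c2 * adj t2 + c3 * adj t3 + c4 * adj t4 + c5 * adj t5))
       + tr (y1 * (c1 * t1 + c2 * t2 + c3 * t3 + c4 * t4 + c5 * t5))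
       - b1 * (c1 + c2 + c3 + c4 + c5)"
    unfolding cf[OF cF(1)] cf[OF cF(2)] cf[OF cF(3)] cf[OF cF(4)] cf[OF cF(5)]
    by (simp only: distrib_left tr_add)  (simp add: algebra_simps)
  also have "\<dots> = 0" unfolding rel sum by (simp add: tr_zero)
  finally have f_sum: "c1 * f t1 + c2 * f t2 + c3 * f t3 + c4 * f t4 + c5 * f t5 = 0" .
  have "c1 * f t1 + c2 * form a2 x2 y2 b2 t2 + c3 * form a3 x3 y3 b3 t3
      + c4 * form a4 x4 y4 b4 t4 + c5 * form a5 x5 y5 b5 t5 = 0"
    using s[THEN step_rel(4), folded c] by (simp add: \<epsilon> f_def)
  then have "c1 * c2 * nrm (t2 - t1) + c1 * c3 * nrm (t3 - t1) + c1 * c4 * nrm (t4 - t1)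
      + c1 * c5 * nrm (t5 - t1) + c2 * c3 * nrm (t3 - t2) + c2 * c4 * nrm (t4 - t2)
      + c2 * c5 * nrm (t5 - t2) + c3 * c4 * nrm (t4 - t3) + c3 * c5 * nrm (t5 - t3)
      + c4 * c5 * nrm (t5 - t4) = 0"
    using f_sum by (simp only: f5 f4 f3 f2 dir) Groebner_Basis.algebra
  then show False
    by (rule pentagon[OF dir cF c_nz(1,2,3) dist sum rel])
qed

text \<open>Distinct vertices on one edge have distinct first coordinates, and distinct consecutive
  edges have distinct directions because they share a vertex.\<close>

lemma cycle_steps:
  assumes "berge_cycle hyperedges k v E"
  obtains t where "\<And>i. i < k \<Longrightarrow> step (t i) (v i) (v ((i + 1) mod k))"
    "\<And>i. i < k \<Longrightarrow> t i \<noteq> t ((i + 1) mod k)"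
proof -
  have k: "2 \<le> k" and inj: "inj_on v {..<k}" "inj_on E {..<k}"
    and EH: "\<And>i. i < k \<Longrightarrow> E i \<in> hyperedges"
    and vE: "\<And>i. i < k \<Longrightarrow> v i \<in> E i \<and> v (Suc i mod k) \<in> E i"
    using assms by (auto simp: berge_cycle_def)
  have "\<forall>i\<in>{..<k}. \<exists>p\<in>params. E i = edge p"
    using EH by (auto simp: hyperedges_def)
  then obtain p where p: "\<And>i. i < k \<Longrightarrow> p i \<in> params \<and> E i = edge (p i)"
    by (metis lessThan_iff)
  define t where "t i = snd (snd (snd (snd (p i))))" for i
  have suc: "Suc i mod k < k" "Suc i mod k \<noteq> i" if "i < k" for i
    using that k by (auto simp: mod_Suc)
  show thesis
  proof (rule that)
    fix i assume i: "i < k"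
    obtain a a' where a: "a \<in> S" "a' \<in> S" "v i = point (p i) a" "v (Suc i mod k) = point (p i) a'"
      using vE[OF i] p[OF i] by (auto simp: edge_def)
    have "v i \<noteq> v (Suc i mod k)"
      using inj(1) i suc[OF i] by (auto dest: inj_onD)
    then have "a \<noteq> a'" using a(3,4) by auto
    have "(i + 1) mod k = Suc i mod k" by simp
    then show "step (t i) (v i) (v ((i + 1) mod k))"
      unfolding t_def using point_step[of "p i" a a'] p[OF i] a \<open>a \<noteq> a'\<close> by metis
    let ?j = "Suc i mod k"
    show "t i \<noteq> t ((i + 1) mod k)"
    proof
      assume "t i = t ((i + 1) mod k)"
      then have eq: "t i = t ?j" by simp
      obtain d where d: "d \<in> S" "v ?j = point (p ?j) d"
        using vE[OF suc(1)[OF i]] p[OF suc(1)[OF i]] unfolding edge_def by blast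
      have "p i = p ?j"
        using a(4) d(2) eq unfolding t_def by (metis point_determines_param)
      then have "E i = E ?j" using p[OF i] p[OF suc(1)[OF i]] by metis
      then show False using inj(2) i suc[OF i] by (auto dest: inj_onD)
    qed
  qed
qed

lemma berge_free_5: "berge_free 5 hyperedges"
  and berge_free_6: "\<epsilon> = 1 \<Longrightarrow> berge_free 6 hyperedges"
proof -
  have no_cycle: False
    if c: "berge_cycle hyperedges k v E" and k: "k = 2 \<or> k = 3 \<or> k = 4 \<or> k = 5 \<and> \<epsilon> = 1" for k v E
  proof -
    obtain t where t: "\<And>i. i < k \<Longrightarrow> step (t i) (v i) (v ((i + 1) mod k))"
      "\<And>i. i < k \<Longrightarrow> t i \<noteq> t ((i + 1) mod k)"
      using cycle_steps[OF c] by blast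
    have st: "step (t i) (v i) (v j)" and neq: "t i \<noteq> t j"
      if "i < k" "j = (i + 1) mod k" for i j
      using t that by simp_all
    from k show False
    proof (elim disjE conjE)
      assume k: "k = 2"
      show False
        by (rule step_closes[of "t 0" "v 0" "v 1" "t 1"]; (rule st neq)?; simp add: k)
    next
      assume k: "k = 3"
      show False
        by (rule no_triangle[of "t 0" "v 0" "v 1" "t 1" "v 2" "t 2"]; (rule st neq)?; simp add: k)
    next
      assume k: "k = 4"
      show False
        by (rule no_quadrangle[of "t 0" "v 0" "v 1" "t 1" "v 2" "t 2" "v 3" "t 3"];
            (rule st neq)?; simp add: k)
    next
      assume k: "k = 5" "\<epsilon> = 1"
      show False
        by (rule no_pentagon[of "t 0" "v 0" "v 1" "t 1" "v 2" "t 2" "v 3" "t 3" "v 4" "t 4"];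
            (rule st neq)?; simp add: k)
    qed
  qed
  have small: "k = 2 \<or> k = 3 \<or> k = 4" if "2 \<le> k" "k < 5" for k :: nat using that by linarith
  have small': "k = 2 \<or> k = 3 \<or> k = 4 \<or> k = 5" if "2 \<le> k" "k < 6" for k :: nat
    using that by linarith
  show "berge_free 5 hyperedges"
    unfolding berge_free_def using no_cycle small by metis
  show "\<epsilon> = 1 \<Longrightarrow> berge_free 6 hyperedges"
    unfolding berge_free_def using no_cycle small' by metis
qed

end

subsection \<open>Finite fields of characteristic three\<close>

text \<open>The smallest prime field of odd characteristic; its algebraic closure serves as the
  ambient field.\<close>

datatype gf3 = G0 | G1 | G2

instantiation gf3 :: field
begin

definition "0 = G0"
definition "1 = G1"
fun uminus_gf3 where "- G0 = G0" | "- G1 = G2" | "- G2 = G1"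
fun plus_gf3 where
  "G0 + y = y" | "x + G0 = x" | "G1 + G1 = G2" | "G2 + G2 = G1" | "G1 + G2 = G0" | "G2 + G1 = G0"
fun times_gf3 where
  "G0 * y = G0" | "x * G0 = G0" | "G1 * y = y" | "G2 * G1 = G2" | "G2 * G2 = G1"
definition "x - y = x + - y" for x y :: gf3
definition "inverse x = x" for x :: gf3
definition "x div y = x * y" for x y :: gf3

instance
proof
  fix x y z :: gf3
  show "x + y + z = x + (y + z)" by (cases x; cases y; cases z) simp_all
  show "x + y = y + x" by (cases x; cases y) simp_all
  show "0 + x = x" by (simp add: zero_gf3_def)
  show "- x + x = 0" by (cases x) (simp_all add: zero_gf3_def)
  show "x - y = x + - y" by (rule minus_gf3_def)
  show "x * y * z = x * (y * z)" by (cases x; cases y; cases z) simp_all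
  show "x * y = y * x" by (cases x; cases y) simp_all
  show "1 * x = x" by (cases x) (simp_all add: one_gf3_def)
  show "(x + y) * z = x * z + y * z" by (cases x; cases y; cases z) simp_all
  show "(0 :: gf3) \<noteq> 1" by (simp add: zero_gf3_def one_gf3_def)
  show "x \<noteq> 0 \<Longrightarrow> inverse x * x = 1"
    by (cases x) (simp_all add: inverse_gf3_def zero_gf3_def one_gf3_def)
  show "x div y = x * inverse y" by (simp add: divide_gf3_def inverse_gf3_def)
  show "inverse (0 :: gf3) = 0" by (rule inverse_gf3_def)
qed

end

lemma CHAR_gf3: "CHAR(gf3) = 3"
proof (rule CHAR_eqI)
  have "(3 :: gf3) = 1 + 1 + 1" by simp
  also have "\<dots> = 0" by (simp only: one_gf3_def zero_gf3_def plus_gf3.simps)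
  finally have three: "(3 :: gf3) = 0" .
  then show "of_nat 3 = (0 :: gf3)" by simp
  fix n :: nat assume n: "of_nat n = (0 :: gf3)"
  have "of_nat n = (of_nat (3 * (n div 3) + n mod 3) :: gf3)" by simp
  also have "\<dots> = of_nat (n mod 3)" unfolding of_nat_add of_nat_mult using three by simp
  finally have "of_nat n = (of_nat (n mod 3) :: gf3)" .
  moreover have "n mod 3 = 0 \<or> n mod 3 = 1 \<or> n mod 3 = 2" by linarith
  ultimately show "3 dvd n"
    using n by (auto simp: one_gf3_def zero_gf3_def numeral_2_eq_2)
qed

text \<open>The polynomial \<open>X^n - X\<close> has derivative -1 because \<open>n\<close> is zero
  in the field, so its roots are simple. Over an algebraically closed field it therefore has
  \<open>n\<close> of them.\<close>

lemma card_power_fixed_points: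
  fixes n :: nat
  assumes "1 < n" and n: "of_nat n = (0 :: 'a :: alg_closed_field)"
  shows "card {x :: 'a. x ^ n = x} = n"
proof -
  define p where "p = monom 1 n - monom (1 :: 'a) 1"
  have deg: "degree p = n"
    using degree_add_eq_left[of "- monom (1 :: 'a) 1" "monom 1 n"] assms(1)
    by (simp add: p_def degree_monom_eq)
  have poly: "poly p x = 0 \<longleftrightarrow> x ^ n = x" for x
    by (simp add: p_def poly_monom)
  have "p \<noteq> 0" using deg assms(1) by auto
  have deriv: "poly (pderiv p) x = - 1" for x
    by (simp add: p_def pderiv_diff pderiv_monom poly_monom n)
  have order: "order x p \<le> 1" for x
  proof (rule ccontr)
    assume "\<not> ?thesis"
    then have "[:- x, 1:] ^ 2 dvd p" by (simp add: order_divides)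
    then obtain u where "p = [:- x, 1:] ^ 2 * u" by (rule dvdE)
    then have "p = [:- x, 1:] * ([:- x, 1:] * u)" by (simp only: power2_eq_square mult.assoc)
    then have "poly (pderiv p) x = 0" by (simp only: pderiv_mult) simp
    then show False by (simp add: deriv)
  qed
  then have count: "count (proots p) x = (if poly p x = 0 then 1 else 0)" for x
    using order[of x] order_root[of p x] \<open>p \<noteq> 0\<close> by (cases "order x p") auto
  obtain A where A: "size A = degree p" "p = smult (lead_coeff p) (\<Prod>x\<in>#A. [:-x, 1:])"
    using alg_closed_imp_factorization[OF \<open>p \<noteq> 0\<close>] by blast
  have "proots p = A"
  proof -
    have "proots p = proots (\<Prod>x\<in>#A. [:-x, 1:])"
      using A(2) \<open>p \<noteq> 0\<close> by (metis proots_smult leading_coeff_0_iff)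
    also have "\<dots> = A"
      by (induction A) (simp_all add: proots_mult prod_mset_zero_iff image_iff del: mult_pCons_left)
    finally show ?thesis .
  qed
  then have "size (proots p) = n" using A(1) deg by simp
  moreover have "proots p = mset_set {x. x ^ n = x}"
    using poly_roots_finite[OF \<open>p \<noteq> 0\<close>]
    by (intro multiset_eqI) (simp add: count poly count_mset_set')
  ultimately show ?thesis by (metis size_mset_set)
qed

text \<open>A power of Frobenius: its fixed field has \<open>q\<close> elements, that of its cube
  \<open>q^3\<close>.\<close>

lemma order_three_endomorphism_power:
  assumes q: "q = 3 ^ s" and s: "0 < s"
  defines "\<sigma> \<equiv> \<lambda>x :: gf3 alg_closure. x ^ q"
  shows "order_three_endomorphism \<sigma>"
    and "card (order_three_endomorphism.F \<sigma>) = q"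
    and "card (order_three_endomorphism.L \<sigma>) = q ^ 3"
proof -
  have char: "CHAR(gf3 alg_closure) = 3" by (simp add: CHAR_gf3)
  show "order_three_endomorphism \<sigma>"
  proof
    fix x y
    show "\<sigma> (x + y) = \<sigma> x + \<sigma> y"
      unfolding \<sigma>_def by (rule freshmans_dream'[where n = s]) (simp_all only: char q, simp)
    show "\<sigma> (x * y) = \<sigma> x * \<sigma> y" by (simp add: \<sigma>_def power_mult_distrib)
    show "\<sigma> 1 = 1" by (simp add: \<sigma>_def)
    have "of_nat 2 \<noteq> (0 :: gf3 alg_closure)"
      unfolding of_nat_eq_0_iff_char_dvd char by simp
    then show "(2 :: gf3 alg_closure) \<noteq> 0" by simp
  qed
  then interpret order_three_endomorphism \<sigma> .
  have zero: "of_nat (3 ^ m) = (0 :: gf3 alg_closure)" if "0 < m" for m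
    unfolding of_nat_eq_0_iff_char_dvd char using that by simp
  have one_less: "1 < (3 :: nat) ^ m" if "0 < m" for m
    using that by (intro one_less_power) simp_all
  show "card F = q"
    unfolding F_def unfolding \<sigma>_def q by (rule card_power_fixed_points[OF one_less[OF s] zero[OF s]])
  have "\<sigma> (\<sigma> (\<sigma> x)) = x ^ (q ^ 3)" for x
    by (simp add: \<sigma>_def power3_eq_cube flip: power_mult)
  moreover have "q ^ 3 = 3 ^ (s * 3)" by (simp add: q power_mult)
  ultimately show "card L = q ^ 3"
    using s unfolding L_def by (simp only:) (intro card_power_fixed_points one_less zero; simp)
qed

text \<open>Greedy extension: an element outside \<open>B\<close> can always be added, and
  \<open>B\<close> has at most \<open>r^3 + r^2 < 2 * (r + 1)^3\<close> elements.\<close>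

lemma Sidon_subset:
  fixes F :: "'a :: field set"
  assumes two: "(2 :: 'a) \<noteq> 0" and F: "finite F" and card_F: "2 * r ^ 3 \<le> card F"
  shows "\<exists>S. S \<subseteq> F \<and> card S = r \<and> finite S \<and>
    (\<forall>a\<in>S. \<forall>b\<in>S. \<forall>c\<in>S. \<forall>d\<in>S. a + c = b + d \<longrightarrow> a = b \<or> a = d)"
  using card_F
proof (induction r)
  case 0
  then show ?case by (intro exI[of _ "{}"]) simp
next
  case (Suc r)
  have "2 * r ^ 3 \<le> 2 * Suc r ^ 3" by (simp add: power_mono)
  then obtain S where S: "S \<subseteq> F" "card S = r" "finite S"
    and Sidon: "\<And>a b c d. a \<in> S \<Longrightarrow> b \<in> S \<Longrightarrow> c \<in> S \<Longrightarrow> d \<in> S \<Longrightarrow> a + c = b + d \<Longrightarrow> a = b \<or> a = d"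
    using Suc by (meson order_trans)
  \<comment> \<open>The first part forbids \<open>x + c = b + d\<close> and, through
    \<open>x = x + x - x\<close>, also \<open>x \<in> S\<close>. The second forbids midpoints, that
    is \<open>x + x = b + d\<close>.\<close>
  define B where "B = (\<lambda>(b, d, c). b + d - c) ` (S \<times> S \<times> S) \<union> (\<lambda>(b, d). (b + d) / 2) ` (S \<times> S)"
  have "card B \<le> card S ^ 3 + card S ^ 2"
    unfolding B_def using S(3)
    by (intro order_trans[OF card_Un_le] add_mono order_trans[OF card_image_le])
      (simp_all add: card_cartesian_product power3_eq_cube power2_eq_square)
  also have "\<dots> < 2 * Suc r ^ 3"
  proof -
    have "r ^ 2 \<le> Suc r ^ 2" by (simp add: power_mono)
    also have "\<dots> \<le> Suc r ^ 3" by (simp add: power_increasing)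
    finally have "r ^ 2 \<le> Suc r ^ 3" .
    moreover have "r ^ 3 < Suc r ^ 3" by (rule power_strict_mono) auto
    ultimately show ?thesis using S(2) by simp
  qed
  finally have "card B < card F" using Suc.prems by simp
  moreover have "finite B" using S(3) by (simp add: B_def)
  ultimately obtain x where x: "x \<in> F" "x \<notin> B"
    by (metis card_mono leD subsetI)
  have sum: "x \<noteq> b + d - c" if "b \<in> S" "c \<in> S" "d \<in> S" for b c d
    using x(2) that unfolding B_def by force
  have double: "x \<noteq> (b + d) / 2" if "b \<in> S" "d \<in> S" for b d
    using x(2) that unfolding B_def by force
  have "x \<notin> S" using sum[of x x x] by auto
  have 1: "x + c \<noteq> b + d" if "b \<in> S" "c \<in> S" "d \<in> S" for b c d
    using sum[OF that] by (simp add: algebra_simps)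
  have 2: "x + x \<noteq> b + d" if "b \<in> S" "d \<in> S" for b d
    using double[OF that] two by (auto simp: field_simps)
  have "a = b \<or> a = d"
    if "a \<in> insert x S" "b \<in> insert x S" "c \<in> insert x S" "d \<in> insert x S" "a + c = b + d" for a b c d
    using that Sidon[of a b c d] 1[of b c d] 1[of b a d] 1[of a d c] 1[of a b c] 2[of b d] 2[of a c]
    by (auto simp: add.commute)
  then show ?case
    using S x \<open>x \<notin> S\<close> by (intro exI[of _ "insert x S"]) auto
qed

subsection \<open>Asymptotics\<close>

lemma berge_ex_mono:
  assumes "M \<le> N"
  shows "berge_ex r g M \<le> berge_ex r g N"
proof -
  have "uniform_hypergraph r {..<M} H \<Longrightarrow> uniform_hypergraph r {..<N} H" for H
    using assms by (fastforce simp: uniform_hypergraph_def)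
  then show ?thesis
    unfolding berge_ex_def
    by (intro Max_mono finite_berge_sizes berge_sizes_nonempty) blast
qed

text \<open>With \<open>q\<close> and \<open>q^3\<close> elements in \<open>F\<close> and
  \<open>L\<close>, the trivial centre gives \<open>r * q^7\<close> vertices and \<open>q^10\<close>
  edges. The centre \<open>F\<close> multiplies both numbers by \<open>q\<close>.\<close>

lemma berge_ex_ge:
  assumes r: "2 \<le> r" and s: "0 < s" "2 * r ^ 3 \<le> 3 ^ s"
  shows "(3 ^ s) ^ 10 \<le> berge_ex r 5 (r * (3 ^ s) ^ 7)"
    and "(3 ^ s) ^ 11 \<le> berge_ex r 6 (r * (3 ^ s) ^ 8)"
proof -
  define q :: nat where "q = 3 ^ s"
  define \<sigma> where "\<sigma> = (\<lambda>x :: gf3 alg_closure. x ^ q)"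
  note \<sigma> = order_three_endomorphism_power[OF q_def s(1), folded \<sigma>_def]
  interpret order_three_endomorphism \<sigma> by (rule \<sigma>(1))
  have q: "0 < q" by (simp add: q_def)
  have fin: "finite F" "finite L" using \<sigma>(2,3) q by (auto intro: card_ge_0_finite)
  obtain S where S: "S \<subseteq> F" "card S = r" "finite S"
    and Sidon: "\<And>a b c d. a \<in> S \<Longrightarrow> b \<in> S \<Longrightarrow> c \<in> S \<Longrightarrow> d \<in> S \<Longrightarrow> a + c = b + d \<Longrightarrow> a = b \<or> a = d"
    using Sidon_subset[OF two_neq_zero fin(1), of r] s(2) \<sigma>(2) unfolding q_def by metis
  interpret flat: hexagon_hypergraph \<sigma> S "{0}" 0
    using r S fin by unfold_locales (auto dest: Sidon)
  have one: "card {0 :: gf3 alg_closure} = 1" by simp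
  interpret full: hexagon_hypergraph \<sigma> S F 1
    using r S fin by unfold_locales (auto dest: Sidon intro: F_closed)
  have "card flat.vertices = r * q ^ 7"
    unfolding flat.card_vertices S \<sigma> one by (simp add: eval_nat_numeral)
  moreover have "card flat.hyperedges = q ^ 10"
    unfolding flat.card_hyperedges S \<sigma> one by (simp add: eval_nat_numeral)
  ultimately show "(3 ^ s) ^ 10 \<le> berge_ex r 5 (r * (3 ^ s) ^ 7)"
    using card_le_berge_ex[OF flat.uniform flat.berge_free_5] S(2) by (simp add: q_def)
  have "card full.vertices = r * q ^ 8"
    unfolding full.card_vertices S \<sigma> by (simp add: eval_nat_numeral)
  moreover have "card full.hyperedges = q ^ 11"
    unfolding full.card_hyperedges S \<sigma> by (simp add: eval_nat_numeral)
  ultimately show "(3 ^ s) ^ 11 \<le> berge_ex r 6 (r * (3 ^ s) ^ 8)"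
    using card_le_berge_ex[OF full.uniform full.berge_free_6[OF refl]] S(2) by (simp add: q_def)
qed

text \<open>For the greatest \<open>s\<close> with \<open>r * (m ^ s) ^ A \<le> N\<close>, the next
  size exceeds \<open>N\<close>, so rounding down to an available size costs at most the factor
  \<open>K = r * m^A\<close>.\<close>

lemma powr_lower_bound_from_geometric:
  fixes f :: "nat \<Rightarrow> nat" and m r A B s\<^sub>0 :: nat
  assumes f: "mono f" and "2 \<le> m" "0 < A" "0 < r"
    and bound: "\<And>s. s\<^sub>0 \<le> s \<Longrightarrow> (m ^ s) ^ B \<le> f (r * (m ^ s) ^ A)"
  shows "\<exists>c>0. \<forall>N \<ge> r * (m ^ s\<^sub>0) ^ A. c * real N powr (B / A) \<le> real (f N)"
proof -
  define K where "K = real (r * m ^ A)"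
  define c where "c = 1 / K powr (B / A)"
  have pos: "0 < K" using assms by (simp add: K_def)
  have "c * real N powr (B / A) \<le> real (f N)" if N: "r * (m ^ s\<^sub>0) ^ A \<le> N" for N
  proof -
    let ?P = "\<lambda>s. r * (m ^ s) ^ A \<le> N"
    \<comment> \<open>This bound makes a greatest such \<open>s\<close> exist.\<close>
    have "s \<le> N" if "?P s" for s
    proof -
      have "s \<le> m ^ s" using \<open>2 \<le> m\<close> power_gt_expt[of m s] by simp
      also have "\<dots> \<le> (m ^ s) ^ A" using assms by (intro self_le_power) auto
      also have "\<dots> \<le> r * (m ^ s) ^ A" using assms by simp
      finally show ?thesis using that by simp
    qed
    then obtain s where s: "?P s" and max: "\<And>s'. ?P s' \<Longrightarrow> s' \<le> s"
      using Nat.ex_has_greatest_nat[of ?P s\<^sub>0 N] N by blast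
    have "\<not> ?P (Suc s)" using max[of "Suc s"] by auto
    then have "N \<le> (r * m ^ A) * (m ^ s) ^ A" by (simp add: power_mult_distrib mult_ac)
    then have "real N \<le> K * real (m ^ s) ^ A"
      unfolding K_def by (metis of_nat_le_iff of_nat_mult of_nat_power)
    then have "real N powr (B / A) \<le> (K * real (m ^ s) ^ A) powr (B / A)"
      by (intro powr_mono2) auto
    also have "\<dots> = K powr (B / A) * (real (m ^ s) ^ A) powr (B / A)"
      by (rule powr_mult)
    also have "(real (m ^ s) ^ A) powr (B / A) = real (m ^ s) ^ B"
      using assms by (simp add: powr_powr flip: powr_realpow)
    finally have "c * real N powr (B / A) \<le> real ((m ^ s) ^ B)"
      using pos by (simp add: c_def field_simps)
    also have "(m ^ s) ^ B \<le> f (r * (m ^ s) ^ A)" using bound max[OF N] by simp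
    also have "\<dots> \<le> f N" using f s by (rule monoD)
    finally show ?thesis by simp
  qed
  moreover have "0 < c" using pos by (simp add: c_def)
  ultimately show ?thesis by blast
qed

theorem theorem1p2:
  fixes r :: nat
  assumes "r \<ge> 3"
  shows "\<exists>c c' :: real. c > 0 \<and> c' > 0 \<and>
    (\<exists>N\<^sub>0. \<forall>N\<ge>N\<^sub>0.
       real (berge_ex r 5 N) \<ge> c * real N powr (10 / 7) \<and>
       real (berge_ex r 6 N) \<ge> c' * real N powr (4 / 3))"
proof -
  define s\<^sub>0 where "s\<^sub>0 = 2 * r ^ 3"
  have large: "0 < s" "2 * r ^ 3 \<le> 3 ^ s" if "s\<^sub>0 \<le> s" for s
  proof -
    have "s < 3 ^ s" by (rule power_gt_expt) simp
    then show "2 * r ^ 3 \<le> 3 ^ s" using that by (simp add: s\<^sub>0_def)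
    show "0 < s" using that assms by (cases s) (auto simp: s\<^sub>0_def)
  qed
  have mono: "mono (berge_ex r g)" for g
    by (intro monoI berge_ex_mono)
  have "\<exists>c>0. \<forall>N \<ge> r * (3 ^ s\<^sub>0) ^ 7. c * real N powr (real 10 / real 7) \<le> real (berge_ex r 5 N)"
    using assms berge_ex_ge(1)[OF _ large]
    by (intro powr_lower_bound_from_geometric mono) auto
  then obtain c where c: "0 < c"
    "\<And>N. r * (3 ^ s\<^sub>0) ^ 7 \<le> N \<Longrightarrow> c * real N powr (10 / 7) \<le> real (berge_ex r 5 N)"
    by auto
  have "\<exists>c>0. \<forall>N \<ge> r * (3 ^ s\<^sub>0) ^ 8. c * real N powr (real 11 / real 8) \<le> real (berge_ex r 6 N)"
    using assms berge_ex_ge(2)[OF _ large]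
    by (intro powr_lower_bound_from_geometric mono) auto
  then obtain c' where c': "0 < c'"
    "\<And>N. r * (3 ^ s\<^sub>0) ^ 8 \<le> N \<Longrightarrow> c' * real N powr (11 / 8) \<le> real (berge_ex r 6 N)"
    by auto
  have "c * real N powr (10 / 7) \<le> real (berge_ex r 5 N)"
    "c' * real N powr (4 / 3) \<le> real (berge_ex r 6 N)"
    if N: "max 1 (r * (3 ^ s\<^sub>0) ^ 7 + r * (3 ^ s\<^sub>0) ^ 8) \<le> N" for N
  proof -
    show "c * real N powr (10 / 7) \<le> real (berge_ex r 5 N)" using N by (intro c) simp
    \<comment> \<open>The construction gives the larger exponent \<open>11 / 8\<close>; comparing
      the powers uses \<open>1 \<le> N\<close>, hence the \<open>max 1\<close> in the
      threshold.\<close>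
    have "c' * real N powr (4 / 3) \<le> c' * real N powr (11 / 8)"
      using N c'(1) by (intro mult_left_mono powr_mono) auto
    also have "\<dots> \<le> real (berge_ex r 6 N)" using N by (intro c') simp
    finally show "c' * real N powr (4 / 3) \<le> real (berge_ex r 6 N)" .
  qed
  then show ?thesis using c(1) c'(1) by blast
qed

end
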